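(* Let $K\subset\mathbb{R}^k$ be a closed convex cone, $A\in\mathbb{R}^{k\times n}$, $b\in\mathbb{R}^k$, and suppose that $S:=\{x\in\mathbb{R}^n: b-Ax\in K\}$ is compact. Let $\|\cdot\|$ be a norm on $\mathbb{R}^n$ with dual norm $\|\cdot\|_*$, let $\delta>0$, and let $a^1,\ldots,a^m\in\mathbb{R}^n$ and $\beta_1,\ldots,\beta_m\in\mathbb{R}$. For $x\in S$ and $i\in\{1,\ldots,m\}$ let $$P_i(x):\quad \tilde f_i(x):=\max_{y}\ \bigl\{\beta_i+(a^i)^Ty\ :\ \|y-x\|\le\delta,\ b-Ay\in K\bigr\},$$ and let its conic dual be $$D_i(x):\quad \min_{\pi}\ \bigl\{\beta_i+\delta\|a^i-A^T\pi\|_*+b^T\pi+(a^i-A^T\pi)^Tx\ :\ \pi\in K^*\bigr\}.$$ Let $i\in\{1,\ldots,m\}$ be given. Suppose that $S$ has a Slater point, and suppose $x\in S$. Then $D_i(x)$ attains its optimum at some $\pi_i^*$ with no duality gap (i.e., the optimal values of $P_i(x)$ and $D_i(x)$ are equal), and furthermore $$p_i:=p_i(x):=a^i-A^T\pi_i^*$$ is a subgradient of the concave function $\tilde f_i(\cdot)$ at $x$. Furthermore, there is a set $B_i\subset S$ of measure zero such that, for all $x\in S\setminus B_i$, $p_i(x)$ is uniquely defined (it is the same for every optimal solution $\pi_i^*$ of $D_i(x)$) and hence $\nabla\tilde f_i(x)=p_i(x)$.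
   Context: The dual norm is $\|v\|_*:=\max\{v^Tx:\|x\|\le1\}$. The dual cone of $K$ is $K^*:=\{s: s^Tz\ge0\ \text{for all } z\in K\}$. $S$ has a Slater point if there exists $x^0\in S$ with $b-Ax^0\in\operatorname{int}K$. For a concave function $f$ on $S$, a vector $g\in\mathbb{R}^n$ is called a subgradient of $f$ at $\hat x\in S$ if $f(x)\le f(\hat x)+g^T(x-\hat x)$ for all $x\in S$. (Each $\tilde f_i$ is concave on the convex set $S$.) Measure zero refers to Lebesgue measure on $\mathbb{R}^n$. *)

theory Defs
  imports "HOL-Analysis.Analysis"
begin

definition is_norm :: "('v::real_vector \<Rightarrow> real) \<Rightarrow> bool" where
  "is_norm N \<longleftrightarrow>
     (\<forall>x. N x \<ge> 0) \<and>
     (\<forall>x. N x = 0 \<longleftrightarrow> x = 0) \<and>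
     (\<forall>c x. N (c *\<^sub>R x) = \<bar>c\<bar> * N x) \<and>
     (\<forall>x y. N (x + y) \<le> N x + N y)"

(* The suprema in this definition and in primal_value below are maxima:
   see dual_norm_attained and primal_value_attained. *)
definition dual_norm :: "('v::euclidean_space \<Rightarrow> real) \<Rightarrow> 'v \<Rightarrow> real" where
  "dual_norm N v = (SUP x\<in>{x. N x \<le> 1}. v \<bullet> x)"

definition dual_cone :: "'v::real_inner set \<Rightarrow> 'v set" where
  "dual_cone K = {s. \<forall>z\<in>K. s \<bullet> z \<ge> 0}"

definition feasible_set :: "real^'n^'k \<Rightarrow> real^'k \<Rightarrow> (real^'k) set \<Rightarrow> (real^'n) set" where
  "feasible_set A b K = {x. b - A *v x \<in> K}"

definition has_slater_point :: "real^'n^'k \<Rightarrow> real^'k \<Rightarrow> (real^'k) set \<Rightarrow> bool" where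
  "has_slater_point A b K \<longleftrightarrow> (\<exists>x0\<in>feasible_set A b K. b - A *v x0 \<in> interior K)"

(* Only the values at feasible x matter. In particular, a gradient statement holding almost
   everywhere in a convex S is unaffected by values outside S, as the frontier of S is null. *)
definition primal_value ::
  "real^'n^'k \<Rightarrow> real^'k \<Rightarrow> (real^'k) set \<Rightarrow> (real^'n \<Rightarrow> real) \<Rightarrow> real \<Rightarrow>
   real^'n \<Rightarrow> real \<Rightarrow> real^'n \<Rightarrow> real" where
  "primal_value A b K N \<delta> a \<beta> x =
     (SUP y\<in>{y. N (y - x) \<le> \<delta> \<and> b - A *v y \<in> K}. \<beta> + a \<bullet> y)"

definition dual_objective ::
  "real^'n^'k \<Rightarrow> real^'k \<Rightarrow> (real^'n \<Rightarrow> real) \<Rightarrow> real \<Rightarrow>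
   real^'n \<Rightarrow> real \<Rightarrow> real^'n \<Rightarrow> real^'k \<Rightarrow> real" where
  "dual_objective A b N \<delta> a \<beta> x \<pi> =
     \<beta> + \<delta> * dual_norm N (a - transpose A *v \<pi>) + b \<bullet> \<pi> + (a - transpose A *v \<pi>) \<bullet> x"

definition dual_value ::
  "real^'n^'k \<Rightarrow> real^'k \<Rightarrow> (real^'k) set \<Rightarrow> (real^'n \<Rightarrow> real) \<Rightarrow> real \<Rightarrow>
   real^'n \<Rightarrow> real \<Rightarrow> real^'n \<Rightarrow> real" where
  "dual_value A b K N \<delta> a \<beta> x = (INF \<pi>\<in>dual_cone K. dual_objective A b N \<delta> a \<beta> x \<pi>)"

definition dual_optimal ::
  "real^'n^'k \<Rightarrow> real^'k \<Rightarrow> (real^'k) set \<Rightarrow> (real^'n \<Rightarrow> real) \<Rightarrow> real \<Rightarrow>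
   real^'n \<Rightarrow> real \<Rightarrow> real^'n \<Rightarrow> real^'k \<Rightarrow> bool" where
  "dual_optimal A b K N \<delta> a \<beta> x \<pi> \<longleftrightarrow>
     is_arg_min (dual_objective A b N \<delta> a \<beta> x) (\<lambda>\<pi>. \<pi> \<in> dual_cone K) \<pi>"

(* Subgradient of a concave function (elsewhere often called a supergradient). *)
definition is_subgradient ::
  "'v::real_inner set \<Rightarrow> ('v \<Rightarrow> real) \<Rightarrow> 'v \<Rightarrow> 'v \<Rightarrow> bool" where
  "is_subgradient S f z g \<longleftrightarrow>
     concave_on S f \<and> z \<in> S \<and> (\<forall>x\<in>S. f x \<le> f z + g \<bullet> (x - z))"

lemma is_norm_continuous_on:
  fixes N :: "'v::euclidean_space \<Rightarrow> real"
  assumes "is_norm N"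
  shows "continuous_on T N"
proof -
  have "convex_on UNIV N"
  proof (rule convex_onI)
    fix t :: real and x y :: 'v
    assume t: "0 < t" "t < 1"
    have "N ((1 - t) *\<^sub>R x + t *\<^sub>R y) \<le> N ((1 - t) *\<^sub>R x) + N (t *\<^sub>R y)"
      using assms unfolding is_norm_def by blast
    also have "\<dots> = (1 - t) * N x + t * N y"
      using assms t unfolding is_norm_def by simp
    finally show "N ((1 - t) *\<^sub>R x + t *\<^sub>R y) \<le> (1 - t) * N x + t * N y" .
  qed simp
  then have "continuous_on UNIV N"
    using convex_on_continuous open_UNIV by blast
  then show ?thesis
    by (rule continuous_on_subset) simp
qed

lemma is_norm_compact_unit_ball:
  fixes N :: "'v::euclidean_space \<Rightarrow> real"
  assumes N: "is_norm N"
  shows "compact {x. N x \<le> 1}"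
proof -
  have "compact (sphere (0::'v) 1)" "sphere (0::'v) 1 \<noteq> {}"
    by auto
  then obtain u where u: "u \<in> sphere 0 1" "\<forall>x\<in>sphere 0 1. N u \<le> N x"
    using continuous_attains_inf[OF _ _ is_norm_continuous_on[OF N]] by blast
  have "u \<noteq> 0" using u by auto
  then have pos: "N u > 0"
    using N unfolding is_norm_def by (metis less_eq_real_def)
  have lower: "N u * norm x \<le> N x" for x
  proof (cases "x = 0")
    case True
    then show ?thesis using N by (simp add: is_norm_def)
  next
    case False
    then have "N u \<le> N ((1 / norm x) *\<^sub>R x)"
      using u by auto
    also have "\<dots> = (1 / norm x) * N x"
      using N unfolding is_norm_def by simp
    finally show ?thesis
      using False by (simp add: field_simps)
  qed
  have "norm x \<le> 1 / N u" if "N x \<le> 1" for x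
    using lower[of x] that pos by (simp add: field_simps)
  then have "bounded {x. N x \<le> 1}"
    unfolding bounded_iff by blast
  moreover have "closed {x. N x \<le> 1}"
    using is_norm_continuous_on[OF N] by (intro closed_Collect_le) auto
  ultimately show ?thesis
    using compact_eq_bounded_closed by blast
qed

lemma dual_norm_attained:
  fixes N :: "'v::euclidean_space \<Rightarrow> real"
  assumes N: "is_norm N"
  shows "\<exists>x. N x \<le> 1 \<and> v \<bullet> x = dual_norm N v \<and> (\<forall>y. N y \<le> 1 \<longrightarrow> v \<bullet> y \<le> v \<bullet> x)"
proof -
  have ne: "{x. N x \<le> 1} \<noteq> {}"
    using N unfolding is_norm_def by (metis empty_Collect_eq zero_le_one)
  have "continuous_on {x. N x \<le> 1} (\<lambda>x. v \<bullet> x)"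
    by (intro continuous_intros)
  from continuous_attains_sup[OF is_norm_compact_unit_ball[OF N] ne this]
  obtain x where x: "N x \<le> 1" "\<And>y. N y \<le> 1 \<Longrightarrow> v \<bullet> y \<le> v \<bullet> x"
    by auto
  then have "dual_norm N v = v \<bullet> x"
    unfolding dual_norm_def by (intro cSup_eq_maximum) auto
  with x show ?thesis by metis
qed

lemma primal_value_attained:
  fixes N :: "real^'n \<Rightarrow> real"
  assumes N: "is_norm N" and S: "compact (feasible_set A b K)"
    and x: "x \<in> feasible_set A b K" and "\<delta> \<ge> 0"
  shows "\<exists>y. N (y - x) \<le> \<delta> \<and> b - A *v y \<in> K \<and> \<beta> + a \<bullet> y = primal_value A b K N \<delta> a \<beta> x \<and>
    (\<forall>z. N (z - x) \<le> \<delta> \<and> b - A *v z \<in> K \<longrightarrow> \<beta> + a \<bullet> z \<le> \<beta> + a \<bullet> y)"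
proof -
  let ?F = "{y. N (y - x) \<le> \<delta> \<and> b - A *v y \<in> K}"
  have F: "?F = feasible_set A b K \<inter> {y. N (y - x) \<le> \<delta>}"
    by (auto simp: feasible_set_def)
  have "continuous_on UNIV (\<lambda>y. N (y - x))"
    by (intro continuous_on_compose2[OF is_norm_continuous_on[OF N, of UNIV]] continuous_intros) auto
  then have "closed {y. N (y - x) \<le> \<delta>}"
    by (intro closed_Collect_le) auto
  then have cF: "compact ?F"
    unfolding F using S by (intro compact_Int_closed)
  have "N (x - x) = 0"
    using N by (simp add: is_norm_def)
  then have "x \<in> ?F"
    using x \<open>\<delta> \<ge> 0\<close> by (simp add: feasible_set_def)
  then have ne: "?F \<noteq> {}" by blast
  have "continuous_on ?F (\<lambda>y. \<beta> + a \<bullet> y)"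
    by (intro continuous_intros)
  from continuous_attains_sup[OF cF ne this]
  obtain y where y: "y \<in> ?F" "\<And>z. z \<in> ?F \<Longrightarrow> \<beta> + a \<bullet> z \<le> \<beta> + a \<bullet> y"
    by auto
  then have "primal_value A b K N \<delta> a \<beta> x = \<beta> + a \<bullet> y"
    unfolding primal_value_def by (intro cSup_eq_maximum) auto
  with y show ?thesis by auto
qed

end

theory Submission
  imports Defs
begin

text \<open>
  Duality. The points $(k - (b - Ay),\; a^T y - v)$, with $y$ in the trust region, $k \in K$ and
  $v$ the maximum of $a^T y$ in the primal problem, form a convex set that contains no point
  $(0, s)$ with $s > 0$. Moving a Slater point slightly towards $x$ keeps it Slater and brings
  it into the trust region, so the projection of this set to the first coordinate covers a
  neighbourhood of $0$. Hence a separating hyperplane cannot be vertical and is the graph of a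
  linear form $\pi$. Its sign on $K$ says $\pi \in K^*$, and maximising over the trust ball
  turns the separation inequality into the statement that the dual objective at $\pi$ is at
  most the primal value (\<open>nonvertical_support\<close>, \<open>strong_duality\<close>).

  Subgradients. For fixed $\pi$ the dual objective is affine in $x$, with slope
  $p = a - A^T \pi$. By weak duality it majorises the primal value on $S$, and for a dual optimal
  $\pi$ it touches it at $x$. An optimal $\pi$ exists at every point, so the value function has
  a touching affine majorant everywhere, which makes it concave and $p$ a subgradient.

  Almost everywhere uniqueness. This is a fact about an arbitrary concave function on an open
  convex set: the points with two subgradients form a null set
  (\<open>nonunique_subgradient_negligible\<close>), and at all others the single subgradient is the
  gradient (\<open>unique_subgradient_imp_GDERIV\<close>). For nullity, restrict to a small ball, where
  subgradients are bounded, and consider the points having two subgradients whose components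
  along a basis vector $e$ differ by at least $\epsilon$. Along a line parallel to $e$ these
  components decrease, so each such point uses up $\epsilon$ of a bounded total variation, and
  the number of such points on a line is bounded uniformly. A compact set with this property is
  null: many small translates of it along $e$ cover any point only boundedly often
  (\<open>negligible_few_points_on_parallel_lines\<close>). Countably many such sets cover the
  exceptional points of the ball. What remains of $S$ outside its interior lies in the
  frontier of a convex set and is null as well.
\<close>

section \<open>Separation by a graph\<close>

text \<open>
  The common core of duality and of the existence of subgradients. The strict downward closure of \<open>G\<close>
  misses the origin, and a vertical hyperplane could not have on one side a set whose
  projection is a neighbourhood of \<open>0\<close>.
\<close>

lemma nonvertical_support:
  fixes G :: "('a::euclidean_space \<times> real) set"
  assumes G: "convex G" and top: "\<And>s. (0, s) \<in> G \<Longrightarrow> s \<le> 0"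
    and r: "r > 0" and near: "\<And>u. norm u < r \<Longrightarrow> \<exists>s. (u, s) \<in> G"
  shows "\<exists>w. \<forall>(u, s)\<in>G. s \<le> w \<bullet> u"
proof -
  \<comment> \<open>The strict inequality keeps the origin out of \<open>H\<close>, even though \<open>G\<close> may contain it.\<close>
  define H where "H = {(u, s). \<exists>t>s. (u, t) \<in> G}"
  have "convex H"
  proof (rule convexI)
    fix X Y :: "'a \<times> real" and c d :: real
    assume XY: "X \<in> H" "Y \<in> H" and cd: "0 \<le> c" "0 \<le> d" "c + d = 1"
    obtain u s u' s' where X: "X = (u, s)" and Y: "Y = (u', s')"
      by (metis surj_pair)
    obtain t t' where t: "s < t" "(u, t) \<in> G" and t': "s' < t'" "(u', t') \<in> G"
      using XY unfolding H_def X Y by auto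
    have "(c *\<^sub>R u + d *\<^sub>R u', c * t + d * t') \<in> G"
      using convexD[OF G t(2) t'(2) cd] by simp
    moreover have "c * s + d * s' < c * t + d * t'"
    proof (cases "c = 0")
      case True
      then show ?thesis using cd t'(1) by simp
    next
      case False
      then have "c * s < c * t" using cd t(1) by simp
      moreover have "d * s' \<le> d * t'"
        using cd t'(1) by (simp add: mult_left_mono)
      ultimately show ?thesis by simp
    qed
    ultimately show "c *\<^sub>R X + d *\<^sub>R Y \<in> H"
      unfolding H_def X Y by auto
  qed
  moreover have "0 \<notin> H"
    using top unfolding H_def zero_prod_def by force
  ultimately obtain W where W0: "W \<noteq> 0" and W: "\<And>X. X \<in> H \<Longrightarrow> 0 \<le> W \<bullet> X"
    using separating_hyperplane_set_0 by blast
  obtain w l where Wwl: "W = (w, l)"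
    by (metis surj_pair)
  have sep: "0 \<le> w \<bullet> u + l * s" if "(u, t) \<in> G" "s < t" for u s t
    using W[of "(u, s)"] that unfolding H_def Wwl by auto
  obtain s0 where s0: "(0, s0) \<in> G"
    using near[of 0] r by auto
  have "l \<le> 0"
  proof (rule ccontr)
    assume "\<not> l \<le> 0"
    then have "l * min (s0 - 1) (-1) < 0"
      by (intro mult_pos_neg) auto
    moreover have "0 \<le> l * min (s0 - 1) (-1)"
      using sep[OF s0, of "min (s0 - 1) (-1)"] by auto
    ultimately show False by simp
  qed
  moreover have "l \<noteq> 0"
  proof
    assume l: "l = 0"
    then have w: "w \<noteq> 0" using W0 Wwl by (auto simp: zero_prod_def)
    \<comment> \<open>A short vector pointing against a vertical hyperplane's normal lies on its wrong side.\<close>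
    define u where "u = - (r / (2 * norm w)) *\<^sub>R w"
    have "norm u < r" using w r by (simp add: u_def)
    then obtain t where "(u, t) \<in> G" using near by blast
    from sep[OF this, of "t - 1"] have "0 \<le> w \<bullet> u" using l by simp
    moreover have "w \<bullet> u < 0"
      using w r by (simp add: u_def)
    ultimately show False by simp
  qed
  ultimately have l: "l < 0" by simp
  have "t \<le> (- (1 / l) *\<^sub>R w) \<bullet> u" if "(u, t) \<in> G" for u t
  proof (rule dense_le)
    fix s assume "s < t"
    from sep[OF that this] show "s \<le> (- (1 / l) *\<^sub>R w) \<bullet> u"
      using l by (simp add: field_simps)
  qed
  then show ?thesis by blast
qed

lemma concave_on_subset:
  assumes "concave_on T f" "S \<subseteq> T" "convex S"
  shows "concave_on S f"
  using assms unfolding concave_on_def by (rule convex_on_subset)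

lemma is_subgradient_subset:
  assumes "is_subgradient T f x g" "S \<subseteq> T" "convex S" "x \<in> S"
  shows "is_subgradient S f x g"
  using assms concave_on_subset unfolding is_subgradient_def by blast

text \<open>The support lemma applied to the hypograph of \<open>f\<close>, moved so that \<open>(x, f x)\<close> is the origin.\<close>

lemma subgradient_exists:
  fixes f :: "'a::euclidean_space \<Rightarrow> real"
  assumes f: "concave_on U f" and U: "open U" and x: "x \<in> U"
  shows "\<exists>g. is_subgradient U f x g"
proof -
  define G where "G = {(u, s). x + u \<in> U \<and> s \<le> f (x + u) - f x}"
  have "convex G"
  proof (rule convexI)
    fix X Y :: "'a \<times> real" and c d :: real
    assume XY: "X \<in> G" "Y \<in> G" and cd: "0 \<le> c" "0 \<le> d" "c + d = 1"
    obtain u s v t where X: "X = (u, s)" and Y: "Y = (v, t)"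
      by (metis surj_pair)
    have us: "x + u \<in> U" "s \<le> f (x + u) - f x" and vt: "x + v \<in> U" "t \<le> f (x + v) - f x"
      using XY unfolding G_def X Y by auto
    have x': "x = c *\<^sub>R x + d *\<^sub>R x"
      using cd by (metis scaleR_add_left scaleR_one)
    then have comb: "x + (c *\<^sub>R u + d *\<^sub>R v) = c *\<^sub>R (x + u) + d *\<^sub>R (x + v)"
      by (simp add: algebra_simps)
    have "c * s + d * t \<le> c * (f (x + u) - f x) + d * (f (x + v) - f x)"
      using us vt cd by (intro add_mono mult_left_mono)
    also have "\<dots> = c * f (x + u) + d * f (x + v) - (c + d) * f x"
      by (simp add: algebra_simps)
    also have "\<dots> \<le> f (c *\<^sub>R (x + u) + d *\<^sub>R (x + v)) - f x"
      using f us vt cd unfolding concave_on_iff by simp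
    finally have "c * s + d * t \<le> f (x + (c *\<^sub>R u + d *\<^sub>R v)) - f x"
      by (simp only: comb)
    moreover have "x + (c *\<^sub>R u + d *\<^sub>R v) \<in> U"
      unfolding comb using convexD[OF concave_on_imp_convex[OF f] us(1) vt(1) cd] .
    ultimately show "c *\<^sub>R X + d *\<^sub>R Y \<in> G"
      unfolding G_def X Y by simp
  qed
  moreover obtain r where r: "r > 0" "ball x r \<subseteq> U"
    using U x openE by blast
  have "\<exists>s. (u, s) \<in> G" if "norm u < r" for u
    using r(2) that by (force simp: G_def dist_norm)
  moreover have "s \<le> 0" if "(0, s) \<in> G" for s
    using that by (simp add: G_def)
  ultimately obtain w where w: "\<forall>(u, s)\<in>G. s \<le> w \<bullet> u"
    using nonvertical_support[OF _ _ r(1)] by blast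
  have "f y \<le> f x + w \<bullet> (y - x)" if "y \<in> U" for y
    using w[rule_format, of "(y - x, f y - f x)"] that by (simp add: G_def)
  then show ?thesis
    using f x unfolding is_subgradient_def by blast
qed

section \<open>Sets meeting parallel lines in few points\<close>

text \<open>
  This replaces an appeal to Fubini by counting. Among \<open>n\<close> translates of \<open>E\<close> by multiples of
  \<open>e / n\<close>, at most \<open>M\<close> contain a given point, because each of them accounts for a point of \<open>E\<close>
  on the same line. All lie in one ball \<open>C\<close>, so \<open>n\<close> times the measure of \<open>E\<close> is at most \<open>M\<close>
  times that of \<open>C\<close>, for every \<open>n\<close>.
\<close>

lemma negligible_few_points_on_parallel_lines:
  fixes E :: "'a::euclidean_space set"
  assumes E: "compact E"
    and few: "\<And>z T. finite T \<Longrightarrow> \<forall>t\<in>T. z + t *\<^sub>R e \<in> E \<Longrightarrow> card T \<le> M"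
  shows "negligible E"
proof -
  have mE: "E \<in> lmeasurable" using E by (rule lmeasurable_compact)
  obtain R where R: "\<And>x. x \<in> E \<Longrightarrow> norm x \<le> R"
    using compact_imp_bounded[OF E] unfolding bounded_iff by blast
  define C where "C = cball (0::'a) (R + norm e)"
  have mC: "C \<in> lmeasurable" unfolding C_def by (rule lmeasurable_cball)
  have iC: "integrable lebesgue (indicator C :: 'a \<Rightarrow> real)"
    using mC by (intro integrable_real_indicator) (auto simp: fmeasurable_def simp del: emeasure_completion)
  have bound: "real n * measure lebesgue E \<le> real M * measure lebesgue C" if n: "n > 0" for n
  proof -
    define F where "F j = (+) ((real j / real n) *\<^sub>R e) ` E" for j
    have mF: "F j \<in> lmeasurable" for j
      unfolding F_def using mE by (rule measurable_translation)
    have iF: "integrable lebesgue (indicator (F j) :: 'a \<Rightarrow> real)" for j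
      using mF by (intro integrable_real_indicator) (auto simp: fmeasurable_def simp del: emeasure_completion)
    have mem: "x \<in> F j \<longleftrightarrow> x + (- (real j / real n)) *\<^sub>R e \<in> E" for x j
      unfolding F_def image_iff by (force simp: algebra_simps intro: bexI[of _ "x + (- (real j / real n)) *\<^sub>R e"])
    have pointwise: "(\<Sum>j<n. indicator (F j) x) \<le> real M * indicator C x" for x
    proof (cases "\<exists>j<n. x \<in> F j")
      case True
      then obtain j y where j: "j < n" and y: "y \<in> E" "x = (real j / real n) *\<^sub>R e + y"
        unfolding F_def by auto
      have "norm x \<le> norm ((real j / real n) *\<^sub>R e) + norm y"
        unfolding y by (rule norm_triangle_ineq)
      also have "norm ((real j / real n) *\<^sub>R e) \<le> norm e"
        using j mult_left_le_one_le[of "norm e" "real j / real n"] by simp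
      finally have xC: "x \<in> C" using R[OF y(1)] by (simp add: C_def)
      define J where "J = {j. j < n \<and> x \<in> F j}"
      have "(\<Sum>j<n. indicator (F j) x) = (\<Sum>j\<in>J. 1::real)"
        unfolding J_def by (intro sum.mono_neutral_cong_right) (auto simp: indicator_def)
      also have "\<dots> = card J" by simp
      also have "card J = card ((\<lambda>j. - (real j / real n)) ` J)"
        using n by (intro card_image[symmetric] inj_onI) simp
      also have "\<dots> \<le> M"
      proof (rule few[of _ x])
        show "finite ((\<lambda>j. - (real j / real n)) ` J)" by (simp add: J_def)
        show "\<forall>t\<in>(\<lambda>j. - (real j / real n)) ` J. x + t *\<^sub>R e \<in> E"
          using mem unfolding J_def by blast
      qed
      finally show ?thesis using xC by simp
    next
      case False
      then have "(\<Sum>j<n. indicator (F j) x) = (0::real)"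
        by (intro sum.neutral) auto
      then show ?thesis by (simp add: indicator_def)
    qed
    have "real n * measure lebesgue E = (\<Sum>j<n. measure lebesgue (F j))"
      by (simp add: F_def measure_translation)
    also have "\<dots> = (\<integral>x. (\<Sum>j<n. indicator (F j) x) \<partial>lebesgue)"
      using iF by (subst Bochner_Integration.integral_sum) auto
    also have "\<dots> \<le> (\<integral>x. real M * indicator C x \<partial>lebesgue)"
      using iF iC pointwise
      by (intro integral_mono Bochner_Integration.integrable_sum integrable_mult_right) auto
    also have "\<dots> = real M * measure lebesgue C"
      using mC by simp
    finally show ?thesis .
  qed
  have "measure lebesgue E = 0"
  proof (rule ccontr)
    assume "measure lebesgue E \<noteq> 0"
    then have pos: "measure lebesgue E > 0" by (simp add: zero_less_measure_iff)
    obtain n where "real M * measure lebesgue C < real n * measure lebesgue E"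
      using reals_Archimedean3[OF pos] by blast
    moreover have "real (Suc n) * measure lebesgue E \<le> real M * measure lebesgue C"
      by (rule bound) simp
    ultimately show False using pos by (simp add: algebra_simps)
  qed
  then show ?thesis using mE by (simp add: negligible_iff_measure)
qed

section \<open>Subgradients of concave functions\<close>

lemma concave_on_continuous_on:
  fixes f :: "'a::euclidean_space \<Rightarrow> real"
  assumes "concave_on U f" "open U"
  shows "continuous_on U f"
  using continuous_on_minus[OF convex_on_continuous[OF assms(2) assms(1)[unfolded concave_on_def]]]
  by simp

lemma subgradient_antimono:
  assumes "is_subgradient U f x p" "is_subgradient U f y q"
  shows "(p - q) \<bullet> (x - y) \<le> 0"
proof -
  have "f y \<le> f x + p \<bullet> (y - x)" "f x \<le> f y + q \<bullet> (x - y)"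
    using assms unfolding is_subgradient_def by blast+
  then show ?thesis by (simp add: inner_simps)
qed

text \<open>
  Closedness holds since each subgradient inequality is a closed condition, \<open>f\<close> being continuous.
  Boundedness holds since a step of length \<open>r\<close> against a subgradient \<open>g\<close> lowers \<open>f\<close> by at least
  \<open>r * norm g\<close>, while \<open>f\<close> is bounded on the ball of radius \<open>2 * r\<close>. Compactness of the graph
  carries both the continuity argument behind differentiability and the measurability of
  the exceptional sets.
\<close>

lemma subgradient_graph_locally_compact:
  fixes f :: "'a::euclidean_space \<Rightarrow> real"
  assumes f: "concave_on U f" and U: "open U" and x0: "x0 \<in> U"
  obtains r where "r > 0" "cball x0 r \<subseteq> U"
    "compact {(x, g). x \<in> cball x0 r \<and> is_subgradient U f x g}"
proof -
  have cont: "continuous_on U f" using f U by (rule concave_on_continuous_on)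
  obtain d where d: "d > 0" "cball x0 d \<subseteq> U"
    using U x0 open_contains_cball by blast
  define r where "r = d / 2"
  have r: "r > 0" and rU: "cball x0 r \<subseteq> U"
    using d by (auto simp: r_def)
  have "compact (f ` cball x0 d)"
    using continuous_on_subset[OF cont d(2)] by (rule compact_continuous_image) simp
  then obtain B where B: "\<And>x. x \<in> cball x0 d \<Longrightarrow> \<bar>f x\<bar> \<le> B"
    using compact_imp_bounded[of "f ` cball x0 d"] unfolding bounded_iff real_norm_def by blast
  have bounded: "norm g \<le> 2 * B / r" if x: "x \<in> cball x0 r" and g: "is_subgradient U f x g" for x g
  proof (cases "g = 0")
    case True
    have "0 \<le> B" using B[of x0] d(1) by simp
    then show ?thesis using r True by simp
  next
    case False
    define y where "y = x - (r / norm g) *\<^sub>R g"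
    have "dist x0 y \<le> dist x0 x + dist x y" by (rule dist_triangle)
    moreover have "dist x y = r" using False r by (simp add: y_def dist_norm)
    ultimately have yd: "y \<in> cball x0 d" using x by (simp add: r_def)
    have xd: "x \<in> cball x0 d" using x r by (auto simp: r_def)
    have "f y \<le> f x + g \<bullet> (y - x)"
      using g yd d(2) unfolding is_subgradient_def by blast
    also have "g \<bullet> (y - x) = - r * norm g"
      using False by (simp add: y_def dot_square_norm power2_eq_square)
    finally show ?thesis
      using B[OF yd] B[OF xd] r by (simp add: field_simps)
  qed
  define \<Gamma> where "\<Gamma> = {(x, g). x \<in> cball x0 r \<and> is_subgradient U f x g}"
  define D where "D = cball x0 r \<times> cball (0::'a) (2 * B / r)"
  have D: "compact D" unfolding D_def by (intro compact_Times compact_cball)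
  have eq: "\<Gamma> = D \<inter> (\<Inter>y\<in>U. {z\<in>D. f y \<le> f (fst z) + snd z \<bullet> (y - fst z)})"
    using rU bounded f unfolding \<Gamma>_def D_def is_subgradient_def by auto
  have "continuous_on D (\<lambda>z. f (fst z))"
    using rU by (intro continuous_on_compose2[OF cont] continuous_intros) (auto simp: D_def)
  then have "closed {z\<in>D. f y \<le> f (fst z) + snd z \<bullet> (y - fst z)}" for y
    by (intro continuous_on_closed_Collect_le continuous_intros compact_imp_closed D)
  then have "compact \<Gamma>"
    unfolding eq by (intro compact_Int_closed D closed_INT) auto
  then show ?thesis using that r rU unfolding \<Gamma>_def by blast
qed

text \<open>
  Compactness of the graph makes subgradients at nearby points \<open>y\<close> close to \<open>p\<close>. The increment
  of \<open>f\<close> from \<open>x\<close> to \<open>y\<close> lies between the linear forms given by a subgradient at \<open>y\<close> and by \<open>p\<close>,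
  whose difference is therefore of smaller order than the distance of \<open>x\<close> and \<open>y\<close>.
\<close>

lemma unique_subgradient_imp_GDERIV:
  fixes f :: "'a::euclidean_space \<Rightarrow> real"
  assumes f: "concave_on U f" and U: "open U" and p: "is_subgradient U f x p"
    and unique: "\<And>q. is_subgradient U f x q \<Longrightarrow> q = p"
  shows "GDERIV f x :> p"
proof -
  have xU: "x \<in> U" using p unfolding is_subgradient_def by blast
  obtain r where r: "r > 0" "cball x r \<subseteq> U"
    and comp: "compact {(y, g). y \<in> cball x r \<and> is_subgradient U f y g}" (is "compact ?\<Gamma>")
    using subgradient_graph_locally_compact[OF f U xU] by blast
  have close: "\<exists>d>0. \<forall>y g. norm (y - x) < d \<and> is_subgradient U f y g \<longrightarrow> norm (g - p) < \<epsilon>"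
    if "\<epsilon> > 0" for \<epsilon>
  proof -
    \<comment> \<open>The points near \<open>x\<close> having a subgradient far from \<open>p\<close>: a compact set that misses \<open>x\<close>.\<close>
    define F where "F = fst ` (?\<Gamma> \<inter> {z. \<epsilon> \<le> norm (snd z - p)})"
    have "closed {z::'a \<times> 'a. \<epsilon> \<le> norm (snd z - p)}"
      by (intro closed_Collect_le continuous_intros)
    then have "compact F"
      unfolding F_def by (intro compact_continuous_image continuous_intros compact_Int_closed comp)
    then have "open (ball x r - F)"
      by (intro open_Diff open_ball compact_imp_closed)
    moreover have "x \<in> ball x r - F"
      using r that unique by (auto simp: F_def)
    ultimately obtain d where d: "d > 0" "ball x d \<subseteq> ball x r - F"
      using openE by blast
    have "norm (g - p) < \<epsilon>" if "norm (y - x) < d" "is_subgradient U f y g" for y g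
    proof (rule ccontr)
      assume "\<not> norm (g - p) < \<epsilon>"
      have y: "y \<in> ball x r - F"
        using d(2) that(1) by (auto simp: dist_norm norm_minus_commute)
      then have "(y, g) \<in> ?\<Gamma> \<inter> {z. \<epsilon> \<le> norm (snd z - p)}"
        using that \<open>\<not> norm (g - p) < \<epsilon>\<close> by auto
      then have "y \<in> F" unfolding F_def by force
      with y show False by blast
    qed
    with d(1) show ?thesis by blast
  qed
  have "(f has_derivative (\<lambda>h. h \<bullet> p)) (at x)"
    unfolding has_derivative_at_alt
  proof (intro conjI allI impI)
    show "bounded_linear (\<lambda>h. h \<bullet> p)" by (rule bounded_linear_inner_left)
    fix \<epsilon> :: real assume "\<epsilon> > 0"
    then obtain d where d: "d > 0"
      "\<And>y g. norm (y - x) < d \<Longrightarrow> is_subgradient U f y g \<Longrightarrow> norm (g - p) < \<epsilon>"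
      using close by blast
    have "norm (f y - f x - (y - x) \<bullet> p) \<le> \<epsilon> * norm (y - x)" if y: "norm (y - x) < min d r" for y
    proof -
      have yU: "y \<in> U" using y r by (auto simp: subset_iff dist_norm norm_minus_commute)
      then obtain g where g: "is_subgradient U f y g"
        using subgradient_exists[OF f U] by blast
      have upper: "f y \<le> f x + p \<bullet> (y - x)" and lower: "f x \<le> f y + g \<bullet> (x - y)"
        using p g xU yU unfolding is_subgradient_def by blast+
      have "(p - g) \<bullet> (y - x) \<le> norm (p - g) * norm (y - x)"
        by (rule norm_cauchy_schwarz)
      also have "\<dots> \<le> \<epsilon> * norm (y - x)"
        using d(2)[OF _ g] y by (intro mult_right_mono) (auto simp: norm_minus_commute)
      finally show ?thesis
        using upper lower by (simp add: inner_simps inner_commute)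
    qed
    then show "\<exists>d>0. \<forall>y. norm (y - x) < d \<longrightarrow> norm (f y - f x - (y - x) \<bullet> p) \<le> \<epsilon> * norm (y - x)"
      using d(1) r(1) by (intro exI[of _ "min d r"]) auto
  qed
  then show ?thesis unfolding gderiv_def .
qed

text \<open>
  The intervals from \<open>Q t\<close> to \<open>P t\<close> have length at least \<open>\<epsilon>\<close>, do not overlap, and lie between
  \<open>l\<close> and \<open>B\<close>. The bound \<open>l\<close> varies in the induction: since the intervals move down as \<open>t\<close> grows,
  those belonging to smaller indices lie above the one of the largest index.
\<close>

lemma card_disjoint_gaps:
  fixes P Q :: "real \<Rightarrow> real"
  assumes "finite T" "\<And>t. t \<in> T \<Longrightarrow> P t \<le> B" "\<And>t. t \<in> T \<Longrightarrow> l \<le> Q t" "l \<le> B"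
    "\<And>t. t \<in> T \<Longrightarrow> Q t + \<epsilon> \<le> P t"
    "\<And>s t. s \<in> T \<Longrightarrow> t \<in> T \<Longrightarrow> s < t \<Longrightarrow> P t \<le> Q s"
  shows "real (card T) * \<epsilon> \<le> B - l"
  using assms
proof (induction T arbitrary: l rule: finite_linorder_max_induct)
  case empty
  then show ?case by simp
next
  case (insert b T)
  have "real (card T) * \<epsilon> \<le> B - P b"
    using insert.hyps insert.prems by (intro insert.IH) auto
  moreover have "Q b + \<epsilon> \<le> P b" "l \<le> Q b"
    using insert.prems by auto
  moreover have "card (insert b T) = Suc (card T)"
    using insert.hyps by (intro card_insert_disjoint) auto
  ultimately show ?case by (simp add: algebra_simps)
qed

text \<open>
  Along a line with direction \<open>e\<close> the components of the subgradients along \<open>e\<close> decrease and are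
  bounded on \<open>C\<close>. So there is room for only boundedly many points at which they spread by \<open>\<epsilon>\<close>.
\<close>

lemma kinks_negligible:
  fixes f :: "'a::euclidean_space \<Rightarrow> real"
  assumes comp: "compact {(x, g). x \<in> C \<and> is_subgradient U f x g}" and "\<epsilon> > 0"
  shows "negligible {x \<in> C. \<exists>p q. is_subgradient U f x p \<and> is_subgradient U f x q \<and>
    \<epsilon> \<le> (p - q) \<bullet> e}" (is "negligible ?E")
proof -
  let ?\<Gamma> = "{(x, g). x \<in> C \<and> is_subgradient U f x g}"
  define D where "D = {zw. fst (fst zw) = (fst (snd zw) :: 'a)} \<inter>
    {zw. \<epsilon> \<le> (snd (fst zw) - snd (snd zw)) \<bullet> e}"
  have "closed D"
    unfolding D_def by (intro closed_Int closed_Collect_eq closed_Collect_le continuous_intros)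
  then have "compact ((?\<Gamma> \<times> ?\<Gamma>) \<inter> D)"
    by (intro compact_Int_closed compact_Times comp)
  then have "compact ((\<lambda>zw. fst (fst zw)) ` ((?\<Gamma> \<times> ?\<Gamma>) \<inter> D))"
    by (intro compact_continuous_image continuous_intros)
  moreover have "?E = (\<lambda>zw. fst (fst zw)) ` ((?\<Gamma> \<times> ?\<Gamma>) \<inter> D)"
    by (force simp: D_def image_iff)
  ultimately have cE: "compact ?E" by simp
  obtain L where L: "\<And>z. z \<in> ?\<Gamma> \<Longrightarrow> norm z \<le> L"
    using compact_imp_bounded[OF comp] unfolding bounded_iff by blast
  define B where "B = \<bar>L\<bar> * norm e"
  have B: "\<bar>g \<bullet> e\<bar> \<le> B" if "x \<in> C" "is_subgradient U f x g" for x g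
  proof -
    have "norm g \<le> norm (x, g)" by (metis norm_snd_le)
    also have "\<dots> \<le> \<bar>L\<bar>" using L[of "(x, g)"] that by auto
    finally have "norm g * norm e \<le> B" unfolding B_def by (rule mult_right_mono) simp
    then show ?thesis using Cauchy_Schwarz_ineq2[of g e] by linarith
  qed
  show ?thesis
  proof (rule negligible_few_points_on_parallel_lines[OF cE])
    fix z :: 'a and T :: "real set"
    assume T: "finite T" and "\<forall>t\<in>T. z + t *\<^sub>R e \<in> ?E"
    then have "\<forall>t\<in>T. \<exists>p q. z + t *\<^sub>R e \<in> C \<and> is_subgradient U f (z + t *\<^sub>R e) p \<and>
        is_subgradient U f (z + t *\<^sub>R e) q \<and> \<epsilon> \<le> (p - q) \<bullet> e"
      by blast
    then obtain P Q where PQ: "\<And>t. t \<in> T \<Longrightarrow> z + t *\<^sub>R e \<in> C"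
        "\<And>t. t \<in> T \<Longrightarrow> is_subgradient U f (z + t *\<^sub>R e) (P t)"
        "\<And>t. t \<in> T \<Longrightarrow> is_subgradient U f (z + t *\<^sub>R e) (Q t)"
        "\<And>t. t \<in> T \<Longrightarrow> \<epsilon> \<le> (P t - Q t) \<bullet> e"
      by metis
    have "real (card T) * \<epsilon> \<le> B - (- B)"
    proof (rule card_disjoint_gaps[where P = "\<lambda>t. P t \<bullet> e" and Q = "\<lambda>t. Q t \<bullet> e"])
      fix t assume t: "t \<in> T"
      show "P t \<bullet> e \<le> B" "- B \<le> Q t \<bullet> e"
        using B[OF PQ(1)[OF t] PQ(2)[OF t]] B[OF PQ(1)[OF t] PQ(3)[OF t]] by linarith+
      show "Q t \<bullet> e + \<epsilon> \<le> P t \<bullet> e"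
        using PQ(4)[OF t] by (simp add: inner_diff_left)
    next
      fix s t assume st: "s \<in> T" "t \<in> T" "s < t"
      have "(P t - Q s) \<bullet> ((z + t *\<^sub>R e) - (z + s *\<^sub>R e)) \<le> 0"
        using PQ st by (intro subgradient_antimono)
      then have "(t - s) * ((P t - Q s) \<bullet> e) \<le> 0"
        by (simp add: algebra_simps)
      then show "P t \<bullet> e \<le> Q s \<bullet> e"
        using st by (simp add: mult_le_0_iff inner_diff_left)
    qed (use T B_def in auto)
    then have "real (card T) \<le> 2 * B / \<epsilon>"
      using \<open>\<epsilon> > 0\<close> by (simp add: field_simps)
    then show "card T \<le> nat \<lfloor>2 * B / \<epsilon>\<rfloor>"
      by (simp add: le_nat_floor)
  qed
qed

text \<open>
  Two different subgradients differ in some coordinate by at least some \<open>1 / (n + 1)\<close>, so near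
  each point countably many of the null sets above suffice, and nullity is a local property.
\<close>

lemma nonunique_subgradient_negligible:
  fixes f :: "'a::euclidean_space \<Rightarrow> real"
  assumes f: "concave_on U f" and U: "open U"
  shows "negligible {x. \<exists>p q. is_subgradient U f x p \<and> is_subgradient U f x q \<and> p \<noteq> q}"
    (is "negligible ?B")
  unfolding locally_negligible_alt[of ?B]
proof
  fix x assume "x \<in> ?B"
  then have xU: "x \<in> U" unfolding is_subgradient_def by blast
  obtain r where r: "r > 0" "cball x r \<subseteq> U"
    and comp: "compact {(y, g). y \<in> cball x r \<and> is_subgradient U f y g}"
    using subgradient_graph_locally_compact[OF f U xU] by blast
  define E where "E e n = {y \<in> cball x r. \<exists>p q. is_subgradient U f y p \<and> is_subgradient U f y q \<and>
    inverse (real (Suc n)) \<le> (p - q) \<bullet> e}" for e n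
  have "negligible (E e n)" for e n
    unfolding E_def by (rule kinks_negligible[OF comp]) simp
  then have neg: "negligible (\<Union>e\<in>Basis. \<Union>n. E e n)"
    by (intro negligible_Union negligible_countable_Union) auto
  have "?B \<inter> ball x r \<subseteq> (\<Union>e\<in>Basis. \<Union>n. E e n)"
  proof
    fix y assume y: "y \<in> ?B \<inter> ball x r"
    then obtain p q where pq: "is_subgradient U f y p" "is_subgradient U f y q" "p \<noteq> q" by blast
    then obtain e where e: "e \<in> Basis" "p \<bullet> e \<noteq> q \<bullet> e" using euclidean_eqI by blast
    have "\<exists>p q. is_subgradient U f y p \<and> is_subgradient U f y q \<and> 0 < (p - q) \<bullet> e"
    proof (cases "q \<bullet> e < p \<bullet> e")
      case True
      then show ?thesis using pq by (intro exI[of _ p] exI[of _ q]) (simp add: inner_diff_left)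
    next
      case False
      then show ?thesis using pq e by (intro exI[of _ q] exI[of _ p]) (simp add: inner_diff_left)
    qed
    then obtain p q where pq: "is_subgradient U f y p" "is_subgradient U f y q" "0 < (p - q) \<bullet> e"
      by blast
    obtain n where "inverse (real (Suc n)) < (p - q) \<bullet> e"
      using reals_Archimedean[OF pq(3)] by blast
    then have "y \<in> E e n" using y pq(1,2) unfolding E_def by force
    with e(1) show "y \<in> (\<Union>e\<in>Basis. \<Union>n. E e n)" by blast
  qed
  then have "negligible (?B \<inter> ball x r)" using neg negligible_subset by blast
  moreover have "openin (top_of_set ?B) (?B \<inter> ball x r)"
    by (intro openin_open_Int open_ball)
  ultimately show "\<exists>V. openin (top_of_set ?B) V \<and> x \<in> V \<and> negligible V"
    using \<open>x \<in> ?B\<close> r(1) by (intro exI[of _ "?B \<inter> ball x r"]) auto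
qed

section \<open>Conic duality over a trust region\<close>

lemma is_norm_convex_ball:
  assumes "is_norm N"
  shows "convex {y. N (y - x) \<le> \<delta>}"
proof (rule convexI, simp)
  fix y z and c d :: real
  assume yz: "N (y - x) \<le> \<delta>" "N (z - x) \<le> \<delta>" and cd: "0 \<le> c" "0 \<le> d" "c + d = 1"
  have "x = c *\<^sub>R x + d *\<^sub>R x"
    using cd by (metis scaleR_add_left scaleR_one)
  then have "c *\<^sub>R y + d *\<^sub>R z - x = c *\<^sub>R (y - x) + d *\<^sub>R (z - x)"
    by (simp add: algebra_simps)
  then have "N (c *\<^sub>R y + d *\<^sub>R z - x) \<le> N (c *\<^sub>R (y - x)) + N (d *\<^sub>R (z - x))"
    using assms unfolding is_norm_def by metis
  also have "\<dots> = c * N (y - x) + d * N (z - x)"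
    using assms cd unfolding is_norm_def by simp
  also have "\<dots> \<le> c * \<delta> + d * \<delta>" using yz cd by (intro add_mono mult_left_mono)
  also have "\<dots> = \<delta>" using cd by (metis distrib_right mult_1)
  finally show "N (c *\<^sub>R y + d *\<^sub>R z - x) \<le> \<delta>" .
qed

text \<open>
  Together the two parts say that the maximum of \<open>v\<close> over the trust ball around \<open>x\<close> is
  $v^T x + \delta \|v\|_*$; this is where the dual norm in the dual objective comes from.
\<close>

lemma dual_norm_ball_max:
  fixes N :: "'v::euclidean_space \<Rightarrow> real"
  assumes N: "is_norm N" and "\<delta> > 0"
  shows "N (y - x) \<le> \<delta> \<Longrightarrow> v \<bullet> y \<le> v \<bullet> x + \<delta> * dual_norm N v"
    and "\<exists>y. N (y - x) \<le> \<delta> \<and> v \<bullet> y = v \<bullet> x + \<delta> * dual_norm N v"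
proof -
  obtain u where u: "N u \<le> 1" "v \<bullet> u = dual_norm N v" "\<And>y. N y \<le> 1 \<Longrightarrow> v \<bullet> y \<le> v \<bullet> u"
    using dual_norm_attained[OF N] by blast
  have scale: "N (c *\<^sub>R z) = \<bar>c\<bar> * N z" for c z
    using N unfolding is_norm_def by blast
  have "N (\<delta> *\<^sub>R u) \<le> \<delta>"
    using u(1) \<open>\<delta> > 0\<close> by (simp add: scale)
  then show "\<exists>y. N (y - x) \<le> \<delta> \<and> v \<bullet> y = v \<bullet> x + \<delta> * dual_norm N v"
    using u(2) by (intro exI[of _ "x + \<delta> *\<^sub>R u"]) (simp add: inner_simps)
  assume "N (y - x) \<le> \<delta>"
  then have "N ((1 / \<delta>) *\<^sub>R (y - x)) \<le> 1"
    using \<open>\<delta> > 0\<close> by (simp add: scale)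
  from u(3)[OF this] show "v \<bullet> y \<le> v \<bullet> x + \<delta> * dual_norm N v"
    using \<open>\<delta> > 0\<close> u(2) by (simp add: field_simps inner_simps)
qed

lemma convex_feasible_set:
  fixes A :: "real^'n^'k"
  assumes "convex K"
  shows "convex (feasible_set A b K)"
proof (rule convexI)
  fix y z and c d :: real
  assume yz: "y \<in> feasible_set A b K" "z \<in> feasible_set A b K" and cd: "0 \<le> c" "0 \<le> d" "c + d = 1"
  have "b = c *\<^sub>R b + d *\<^sub>R b"
    using cd by (metis scaleR_add_left scaleR_one)
  then have "b - A *v (c *\<^sub>R y + d *\<^sub>R z) = c *\<^sub>R (b - A *v y) + d *\<^sub>R (b - A *v z)"
    by (simp add: matrix_vector_right_distrib matrix_vector_mult_scaleR algebra_simps)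
  also have "\<dots> \<in> K"
    using convexD[OF assms _ _ cd] yz by (simp add: feasible_set_def)
  finally show "c *\<^sub>R y + d *\<^sub>R z \<in> feasible_set A b K"
    by (simp add: feasible_set_def)
qed

lemma weak_duality:
  assumes N: "is_norm N" and "\<delta> > 0" and "\<pi> \<in> dual_cone K"
    and y: "N (y - x) \<le> \<delta>" "b - A *v y \<in> K"
  shows "\<beta> + a \<bullet> y \<le> dual_objective A b N \<delta> a \<beta> x \<pi>"
proof -
  have "(a - transpose A *v \<pi>) \<bullet> y \<le>
      (a - transpose A *v \<pi>) \<bullet> x + \<delta> * dual_norm N (a - transpose A *v \<pi>)"
    using dual_norm_ball_max(1)[OF N \<open>\<delta> > 0\<close> y(1)] .
  moreover have "0 \<le> \<pi> \<bullet> (b - A *v y)"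
    using assms unfolding dual_cone_def by blast
  ultimately show ?thesis
    unfolding dual_objective_def
    by (simp add: inner_diff_left inner_diff_right dot_lmul_matrix inner_commute[of b])
qed

text \<open>
  The segment from \<open>x\<close> to a Slater point consists, apart possibly from \<open>x\<close>, of Slater points, and its
  points close to \<open>x\<close> lie in the trust region.
\<close>

lemma slater_point_in_trust_region:
  fixes A :: "real^'n^'k"
  assumes K: "convex K" and "has_slater_point A b K" and x: "x \<in> feasible_set A b K"
    and N: "is_norm N" and "\<delta> > 0"
  obtains y where "N (y - x) \<le> \<delta>" "b - A *v y \<in> interior K"
proof -
  obtain x0 where x0: "b - A *v x0 \<in> interior K"
    using assms unfolding has_slater_point_def by blast
  \<comment> \<open>The summand 1 keeps the denominator positive when \<open>x\<close> is itself the Slater point.\<close>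
  define t where "t = min 1 (\<delta> / (N (x0 - x) + 1))"
  have N0: "N (x0 - x) \<ge> 0" using N unfolding is_norm_def by blast
  have t: "0 < t" "t \<le> 1" using \<open>\<delta> > 0\<close> N0 by (auto simp: t_def)
  define y where "y = x - t *\<^sub>R (x - x0)"
  have "N (y - x) = t * N (x0 - x)"
    using N t unfolding is_norm_def y_def
    by (metis abs_of_pos add_diff_cancel_left' diff_conv_add_uminus minus_diff_eq scaleR_minus_right)
  also have "\<dots> \<le> \<delta> / (N (x0 - x) + 1) * (N (x0 - x) + 1)"
    using N0 \<open>\<delta> > 0\<close> by (intro mult_mono) (auto simp: t_def)
  also have "\<dots> = \<delta>" using N0 by simp
  finally have 1: "N (y - x) \<le> \<delta>" .
  have "A *v y = A *v x - t *\<^sub>R (A *v x - A *v x0)"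
    by (simp add: y_def matrix_vector_mult_diff_distrib matrix_vector_mult_scaleR)
  then have "b - A *v y = (b - A *v x) - t *\<^sub>R ((b - A *v x) - (b - A *v x0))"
    by (simp add: algebra_simps)
  moreover have "b - A *v x \<in> K" using x by (simp add: feasible_set_def)
  ultimately have "b - A *v y \<in> interior K"
    using mem_interior_convex_shrink[OF K x0 _ t] by metis
  with 1 that show ?thesis by blast
qed

text \<open>
  The first coordinate of \<open>G\<close> measures by how much the constraint \<open>b - A *v y \<in> K\<close> is
  relaxed, and the second the resulting gain over the optimal value \<open>v\<close>. A multiplier is the slope
  of a linear bound on the gain in terms of the relaxation.
\<close>

lemma strong_duality:
  fixes A :: "real^'n^'k" and N :: "real^'n \<Rightarrow> real"
  assumes K: "convex_cone K" and S: "compact (feasible_set A b K)"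
    and slater: "has_slater_point A b K" and x: "x \<in> feasible_set A b K"
    and N: "is_norm N" and \<delta>: "\<delta> > 0"
  obtains \<pi> where "\<pi> \<in> dual_cone K"
    "dual_objective A b N \<delta> a \<beta> x \<pi> = primal_value A b K N \<delta> a \<beta> x"
proof -
  obtain y0 where y0: "N (y0 - x) \<le> \<delta>" "b - A *v y0 \<in> K"
      "\<beta> + a \<bullet> y0 = primal_value A b K N \<delta> a \<beta> x"
    and max: "\<And>y. N (y - x) \<le> \<delta> \<Longrightarrow> b - A *v y \<in> K \<Longrightarrow> \<beta> + a \<bullet> y \<le> \<beta> + a \<bullet> y0"
    using primal_value_attained[OF N S x less_imp_le[OF \<delta>], of \<beta> a] by blast
  define v where "v = a \<bullet> y0"
  have convK: "convex K" using K by (simp add: convex_cone_def)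
  define G where "G = (\<lambda>(y, k). (k - (b - A *v y), a \<bullet> y - v)) ` ({y. N (y - x) \<le> \<delta>} \<times> K)"
  have "G = (+) (- b, - v) ` ((\<lambda>z. (snd z + A *v fst z, a \<bullet> fst z)) ` ({y. N (y - x) \<le> \<delta>} \<times> K))"
    unfolding G_def image_image by (rule image_cong) auto
  moreover have "linear (\<lambda>z::(real^'n) \<times> (real^'k). (snd z + A *v fst z, a \<bullet> fst z))"
    by (rule linearI) (auto simp: matrix_vector_right_distrib matrix_vector_mult_scaleR inner_simps algebra_simps)
  ultimately have "convex G"
    using is_norm_convex_ball[OF N] convK
    by (simp add: convex_translation convex_linear_image convex_Times)
  moreover have "s \<le> 0" if "(0, s) \<in> G" for s
    using that max unfolding G_def v_def by auto
  moreover obtain y1 where y1: "N (y1 - x) \<le> \<delta>" "b - A *v y1 \<in> interior K"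
    using slater_point_in_trust_region[OF convK slater x N \<delta>] .
  obtain r where r: "r > 0" "ball (b - A *v y1) r \<subseteq> K"
    using y1(2) mem_interior by blast
  have "\<exists>s. (u, s) \<in> G" if "norm u < r" for u
  proof -
    have "(b - A *v y1) + u \<in> K" using r(2) that by (auto simp: dist_norm)
    then have "(\<lambda>(y, k). (k - (b - A *v y), a \<bullet> y - v)) (y1, (b - A *v y1) + u) \<in> G"
      unfolding G_def using y1(1) by (intro imageI) auto
    then show ?thesis by auto
  qed
  ultimately obtain \<pi> where \<pi>: "\<forall>(u, s)\<in>G. s \<le> \<pi> \<bullet> u"
    using nonvertical_support[OF _ _ r(1)] by blast
  have ineq: "a \<bullet> y - v \<le> \<pi> \<bullet> (k - (b - A *v y))" if "N (y - x) \<le> \<delta>" "k \<in> K" for y k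
    using \<pi> that unfolding G_def by auto
  \<comment> \<open>The maximiser satisfies the constraint relaxed by \<open>k \<in> K\<close> too, with gain 0.\<close>
  have "\<pi> \<bullet> k \<ge> 0" if k: "k \<in> K" for k
  proof -
    have "b - A *v y0 + k \<in> K" using K y0(2) k by (rule convex_cone_add)
    from ineq[OF y0(1) this] show ?thesis by (simp add: v_def)
  qed
  then have dual: "\<pi> \<in> dual_cone K" unfolding dual_cone_def by blast
  \<comment> \<open>At the point of the trust ball where \<open>a - transpose A *v \<pi>\<close> is largest, the bound with \<open>k = 0\<close>
    is the claim that the dual objective is at most the primal value.\<close>
  obtain y where y: "N (y - x) \<le> \<delta>" "(a - transpose A *v \<pi>) \<bullet> y =
      (a - transpose A *v \<pi>) \<bullet> x + \<delta> * dual_norm N (a - transpose A *v \<pi>)"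
    using dual_norm_ball_max(2)[OF N \<delta>] by blast
  have "0 \<in> K" using K by (rule convex_cone_contains_0)
  from ineq[OF y(1) this] have "dual_objective A b N \<delta> a \<beta> x \<pi> \<le> \<beta> + v"
    using y(2) unfolding dual_objective_def
    by (simp add: inner_diff_left inner_diff_right dot_lmul_matrix inner_commute[of b])
  moreover have "\<beta> + v \<le> dual_objective A b N \<delta> a \<beta> x \<pi>"
    unfolding v_def using weak_duality[OF N \<delta> dual y0(1,2)] .
  ultimately show ?thesis using that dual y0(3) unfolding v_def by auto
qed

theorem proposition2:
  fixes K :: "(real^'k) set"
    and A :: "real^'n^'k"
    and b :: "real^'k"
    and N :: "real^'n \<Rightarrow> real"
    and \<delta> :: real
    and m i :: nat
    and a :: "nat \<Rightarrow> real^'n"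
    and \<beta> :: "nat \<Rightarrow> real"
  defines "S \<equiv> feasible_set A b K"
    and "f \<equiv> primal_value A b K N \<delta> (a i) (\<beta> i)"
    and "p \<equiv> (\<lambda>\<pi>. a i - transpose A *v \<pi>)"
    and "opt \<equiv> dual_optimal A b K N \<delta> (a i) (\<beta> i)"
  assumes "closed K" and "convex_cone K"
    and "compact S"
    and "is_norm N"
    and "\<delta> > 0"
    and "i \<in> {1..m}"
    and "has_slater_point A b K"
  shows "(\<forall>x\<in>S. (\<exists>\<pi>. opt x \<pi>) \<and>
           f x = dual_value A b K N \<delta> (a i) (\<beta> i) x \<and>
           (\<forall>\<pi>. opt x \<pi> \<longrightarrow> is_subgradient S f x (p \<pi>))) \<and>
         (\<exists>B. B \<subseteq> S \<and> B \<in> null_sets lebesgue \<and>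
           (\<forall>x\<in>S - B.
              (\<forall>\<pi> \<pi>'. opt x \<pi> \<and> opt x \<pi>' \<longrightarrow> p \<pi> = p \<pi>') \<and>
              (\<forall>\<pi>. opt x \<pi> \<longrightarrow> GDERIV f x :> p \<pi>)))"
proof -
  let ?g = "dual_objective A b N \<delta> (a i) (\<beta> i)"
  note N = \<open>is_norm N\<close> and \<delta> = \<open>\<delta> > 0\<close>
  have convS: "convex S"
    unfolding S_def using \<open>convex_cone K\<close> by (intro convex_feasible_set) (simp add: convex_cone_def)
  have weak: "f x \<le> ?g x \<pi>" if x: "x \<in> S" and \<pi>: "\<pi> \<in> dual_cone K" for x \<pi>
  proof -
    obtain y where "N (y - x) \<le> \<delta>" "b - A *v y \<in> K" "\<beta> i + a i \<bullet> y = f x"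
      using primal_value_attained[OF N \<open>compact S\<close>[unfolded S_def] x[unfolded S_def], of \<delta> "\<beta> i" "a i"] \<delta>
      unfolding f_def by auto
    then show ?thesis using weak_duality[OF N \<delta> \<pi>] by metis
  qed
  have strong: "\<exists>\<pi>\<in>dual_cone K. ?g x \<pi> = f x" if x: "x \<in> S" for x
    using strong_duality[OF \<open>convex_cone K\<close> \<open>compact S\<close>[unfolded S_def] \<open>has_slater_point A b K\<close>
        x[unfolded S_def] N \<delta>, of "a i" "\<beta> i"] unfolding f_def by blast
  have opt_iff: "opt x \<pi> \<longleftrightarrow> \<pi> \<in> dual_cone K \<and> ?g x \<pi> = f x" if x: "x \<in> S" for x \<pi>
    using strong[OF x] weak[OF x] unfolding opt_def dual_optimal_def is_arg_min_linorder
    by (metis order.antisym)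
  have affine: "?g z \<pi> = ?g x \<pi> + p \<pi> \<bullet> (z - x)" for x z \<pi>
    unfolding dual_objective_def p_def by (simp add: inner_diff_right)
  have majorant: "f z \<le> f x + p \<pi> \<bullet> (z - x)" if "x \<in> S" "z \<in> S" "opt x \<pi>" for x z \<pi>
    using weak[OF that(2), of \<pi>] that opt_iff affine[of z \<pi> x] by auto
  have conc: "concave_on S f"
    unfolding concave_on_iff
  proof (intro conjI convS ballI allI impI)
    fix y z and c d :: real
    assume yz: "y \<in> S" "z \<in> S" and cd: "0 \<le> c" "0 \<le> d" "c + d = 1"
    define x where "x = c *\<^sub>R y + d *\<^sub>R z"
    have x: "x \<in> S" unfolding x_def using convexD[OF convS yz cd] .
    then obtain \<pi> where \<pi>: "opt x \<pi>" using strong opt_iff by blast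
    have "c * f y + d * f z \<le> c * (f x + p \<pi> \<bullet> (y - x)) + d * (f x + p \<pi> \<bullet> (z - x))"
      using majorant[OF x _ \<pi>] yz cd by (intro add_mono mult_left_mono)
    also have "\<dots> = (c + d) * f x + p \<pi> \<bullet> (c *\<^sub>R y + d *\<^sub>R z - (c + d) *\<^sub>R x)"
      by (simp add: inner_simps algebra_simps)
    also have "\<dots> = f x" using cd by (simp add: x_def)
    finally show "c * f y + d * f z \<le> f (c *\<^sub>R y + d *\<^sub>R z)" unfolding x_def .
  qed
  have sub: "is_subgradient S f x (p \<pi>)" if "x \<in> S" "opt x \<pi>" for x \<pi>
    using conc majorant that unfolding is_subgradient_def by blast
  have gap: "f x = dual_value A b K N \<delta> (a i) (\<beta> i) x" if x: "x \<in> S" for x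
  proof -
    obtain \<pi> where "\<pi> \<in> dual_cone K" "?g x \<pi> = f x" using strong[OF x] by blast
    then show ?thesis
      unfolding dual_value_def using weak[OF x]
      by (intro cInf_eq_minimum[symmetric]) (auto simp: image_iff intro!: bexI[of _ \<pi>])
  qed
  let ?U = "interior S"
  define B where "B = (S - ?U) \<union>
    {x. \<exists>g h. is_subgradient ?U f x g \<and> is_subgradient ?U f x h \<and> g \<noteq> h}"
  have concU: "concave_on ?U f"
    using concave_on_subset[OF conc interior_subset convex_interior[OF convS]] .
  have "S - ?U \<subseteq> frontier S" unfolding frontier_def using closure_subset by blast
  then have "negligible (S - ?U)"
    using negligible_convex_frontier[OF convS] negligible_subset by blast
  then have "negligible B"
    unfolding B_def using nonunique_subgradient_negligible[OF concU open_interior]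
    by (rule negligible_Un)
  then have null: "B \<in> null_sets lebesgue" by (simp add: negligible_iff_null_sets)
  have "B \<subseteq> S"
    unfolding B_def is_subgradient_def using interior_subset by blast
  have subU: "x \<in> ?U \<and> is_subgradient ?U f x (p \<pi>)" if "x \<in> S - B" "opt x \<pi>" for x \<pi>
    using that sub is_subgradient_subset[OF _ interior_subset convex_interior[OF convS]]
    unfolding B_def by blast
  have unique: "g = h" if "x \<in> S - B" "is_subgradient ?U f x g" "is_subgradient ?U f x h" for x g h
    using that unfolding B_def by blast
  have "GDERIV f x :> p \<pi>" if "x \<in> S - B" "opt x \<pi>" for x \<pi>
    using unique_subgradient_imp_GDERIV[OF concU open_interior] subU[OF that] unique[OF that(1)] by blast
  moreover have "p \<pi> = p \<pi>'" if "x \<in> S - B" "opt x \<pi>" "opt x \<pi>'" for x \<pi> \<pi>'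
    using unique subU that by blast
  moreover have "\<exists>\<pi>. opt x \<pi>" if "x \<in> S" for x using strong opt_iff that by blast
  ultimately show ?thesis
    using gap sub null \<open>B \<subseteq> S\<close> by blast
qed

end
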